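(* Consider the spot market at a slot $t$ with available bids $\mathcal{A}_t$, $A_t=|\mathcal{A}_t|\ge 1$, sorted bid prices $v_1\ge v_2\ge\cdots\ge v_{A_t}\ge 0$, capacity $M_t$, and revenue function $\mathcal{G}(t)=\hat{\mathcal{G}}(\pi_t,M_t,\mathcal{A}_t,f_t)=(N_t-\beta f_t)\frac{\pi_t}{L}$ of the spot price $\pi_t\ge 0$, as described in the context. Let $v_0=v_1+1$ and $\mathcal{V}_t=\{v_0,v_1,\ldots,v_{A_t}\}$. Then the optimal spot price $\pi_t^*$ (maximizing the revenue over all spot prices $\pi_t\ge 0$) is given by $$\pi_t^*\in\arg\max_{\pi_t\in\mathcal{V}_t}\hat{\mathcal{G}}(\pi_t,M_t,\mathcal{A}_t,f_t),$$ that is, any maximizer of $\hat{\mathcal{G}}$ over the finite set $\mathcal{V}_t$ maximizes $\hat{\mathcal{G}}$ over all $\pi_t\ge 0$.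
   Context: Setting at a fixed slot $t$. There is a finite set $\mathcal{A}_t=\mathcal{J}_t'\cup\mathcal{J}_t''$ (disjoint union) of bids, indexed $1,\ldots,A_t$ in non-increasing order of bid price $v_1\ge\cdots\ge v_{A_t}\ge 0$ (ties ordered in a fixed way). $\mathcal{J}_t'$ are the bids of users whose bids were also accepted at slot $t-1$ (each such user was executing on some server during slot $t-1$); $\mathcal{J}_t''$ are the newly arriving bids. After high-priority on-demand jobs have been assigned to servers at $t$, exactly $M_t\in\mathbb{Z}_{\ge 0}$ servers are idle. Acceptance rule: for a spot price $\pi_t\ge 0$ let $F(\pi_t,\mathcal{A}_t)=\{i\in\mathcal{A}_t: v_i\ge\pi_t\}$. The number of accepted bids is $N_t=\min\{M_t,|F(\pi_t,\mathcal{A}_t)|\}$, and the accepted bids are the $N_t$ bids with highest price, i.e. bids $1,\ldots,N_t$. Let $\hat{\mathcal{J}}_t'$ and $\hat{\mathcal{J}}_t''$ be the accepted bids in $\mathcal{J}_t'$ and $\mathcal{J}_t''$. Let $\hat{\mathcal{J}}_{t,1}'\subseteq\hat{\mathcal{J}}_t'$ be those accepted bids whose server from slot $t-1$ has been taken by an on-demand job at $t$ (so they must be migrated); which bids of $\mathcal{J}_t'$ have had their server taken is already fixed before the spot price is chosen. Let $f_t=|\hat{\mathcal{J}}_t''\cup\hat{\mathcal{J}}_{t,1}'|$, which is determined by the set of accepted bids, with $0\le f_t\le N_t$. Billing: $L$ is a positive integer (number of slots in a billing interval) and $\beta\in(0,1)$ is the fraction of a slot lost to loading/migrating a virtual machine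 image. Each accepted bid in $\hat{\mathcal{J}}_t''\cup\hat{\mathcal{J}}_{t,1}'$ is charged $(1-\beta)\pi_t/L$; every other accepted bid is charged $\pi_t/L$. The spot revenue is thus $\mathcal{G}(t)=(N_t-f_t)\frac{\pi_t}{L}+f_t(1-\beta)\frac{\pi_t}{L}=(N_t-\beta f_t)\frac{\pi_t}{L}$, a function of $\pi_t$ (both $N_t$ and $f_t$ depend on $\pi_t$ via the set of accepted bids). *)

theory Defs
  imports Complex_Main
begin

text \<open>
  Bids are identified with their positions \<open>1, \<dots>, A\<close> in the list sorted by non-increasing price,
  so a set of bids is a set of natural numbers, and \<open>v i\<close> is the price of bid \<open>i\<close>.  The value
  \<open>v 0\<close> is never used; the extra candidate price \<open>v\<^sub>0 = v\<^sub>1 + 1\<close> is added in \<open>candidate_prices\<close>.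
\<close>

definition bids_at_least :: "(nat \<Rightarrow> real) \<Rightarrow> nat set \<Rightarrow> real \<Rightarrow> nat set" where
  "bids_at_least v B p = {i \<in> B. v i \<ge> p}"

definition num_accepted :: "(nat \<Rightarrow> real) \<Rightarrow> nat \<Rightarrow> nat set \<Rightarrow> real \<Rightarrow> nat" where
  "num_accepted v M B p = min M (card (bids_at_least v B p))"

text \<open>For \<open>B = {1..A}\<close> with prices in non-increasing order these are the highest-priced bids.\<close>

definition accepted :: "(nat \<Rightarrow> real) \<Rightarrow> nat \<Rightarrow> nat set \<Rightarrow> real \<Rightarrow> nat set" where
  "accepted v M B p = {1..num_accepted v M B p}"

text \<open>
  \<open>Jold\<close> are the bids already accepted at the previous slot, \<open>Jnew\<close> the new arrivals; \<open>srv i\<close> is the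
  server on which bid \<open>i \<in> Jold\<close> ran during the previous slot (irrelevant for other \<open>i\<close>), and
  \<open>taken\<close> is the set of servers claimed by on-demand jobs at the current slot.
\<close>

definition accepted_migrated ::
  "(nat \<Rightarrow> real) \<Rightarrow> nat \<Rightarrow> nat set \<Rightarrow> nat set \<Rightarrow> (nat \<Rightarrow> 's) \<Rightarrow> 's set \<Rightarrow> real \<Rightarrow> nat set" where
  "accepted_migrated v M Jold Jnew srv taken p =
     {i \<in> accepted v M (Jold \<union> Jnew) p \<inter> Jold. srv i \<in> taken}"

definition num_loading ::
  "(nat \<Rightarrow> real) \<Rightarrow> nat \<Rightarrow> nat set \<Rightarrow> nat set \<Rightarrow> (nat \<Rightarrow> 's) \<Rightarrow> 's set \<Rightarrow> real \<Rightarrow> nat" where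
  "num_loading v M Jold Jnew srv taken p =
     card ((accepted v M (Jold \<union> Jnew) p \<inter> Jnew) \<union> accepted_migrated v M Jold Jnew srv taken p)"

definition revenue ::
  "nat \<Rightarrow> real \<Rightarrow> (nat \<Rightarrow> real) \<Rightarrow> nat \<Rightarrow> nat set \<Rightarrow> nat set \<Rightarrow> (nat \<Rightarrow> 's) \<Rightarrow> 's set \<Rightarrow> real \<Rightarrow> real" where
  "revenue L \<beta> v M Jold Jnew srv taken p =
     (real (num_accepted v M (Jold \<union> Jnew) p) - \<beta> * real (num_loading v M Jold Jnew srv taken p))
       * (p / real L)"

definition candidate_prices :: "(nat \<Rightarrow> real) \<Rightarrow> nat \<Rightarrow> real set" where
  "candidate_prices v A = insert (v 1 + 1) (v ` {1..A})"

end

(* Between two consecutive bid prices the set of accepted bids, hence also N and f, is constant, and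
   the revenue is (N - beta f) p / L with N - beta f \<ge> 0.  Raising the price to the lowest bid that
   still passes it therefore cannot decrease the revenue.  If no bid passes, the revenue is 0, as it
   is at v 1 + 1. *)
theory Submission
  imports Defs
begin

text \<open>Only accepted bids can be newly started or migrated. This bound gives
  \<open>N - \<beta> f\<close> its sign and forces \<open>f = 0\<close> when nothing is
  accepted.\<close>

lemma num_loading_le_num_accepted:
  "num_loading v M Jold Jnew srv taken p \<le> num_accepted v M (Jold \<union> Jnew) p"
proof -
  have "num_loading v M Jold Jnew srv taken p \<le> card (accepted v M (Jold \<union> Jnew) p)"
    unfolding num_loading_def
    by (rule card_mono) (auto simp: accepted_def accepted_migrated_def)
  then show ?thesis by (simp add: accepted_def)
qed

lemma revenue_eq_0:
  assumes "bids_at_least v (Jold \<union> Jnew) p = {}"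
  shows "revenue L \<beta> v M Jold Jnew srv taken p = 0"
proof -
  have "num_accepted v M (Jold \<union> Jnew) p = 0"
    using assms by (simp add: num_accepted_def)
  then show ?thesis
    using num_loading_le_num_accepted[of v M Jold Jnew srv taken p] by (simp add: revenue_def)
qed

lemma revenue_mono_same_bids:
  assumes same: "bids_at_least v (Jold \<union> Jnew) q = bids_at_least v (Jold \<union> Jnew) p"
    and "p \<le> q" "\<beta> \<le> 1"
  shows "revenue L \<beta> v M Jold Jnew srv taken p \<le> revenue L \<beta> v M Jold Jnew srv taken q"
proof -
  let ?N = "real (num_accepted v M (Jold \<union> Jnew) p)"
  let ?f = "real (num_loading v M Jold Jnew srv taken p)"
  have N: "num_accepted v M (Jold \<union> Jnew) q = num_accepted v M (Jold \<union> Jnew) p"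
    by (simp add: num_accepted_def same)
  \<comment> \<open>The accepted set is the initial segment \<open>{1..N}\<close>, so equal counts
    already mean equal sets, and \<open>f\<close> depends on the price only through that
    set.\<close>
  then have f: "num_loading v M Jold Jnew srv taken q = num_loading v M Jold Jnew srv taken p"
    by (simp add: num_loading_def accepted_migrated_def accepted_def)
  have "\<beta> * ?f \<le> 1 * ?f"
    using \<open>\<beta> \<le> 1\<close> by (intro mult_right_mono) auto
  then have "0 \<le> ?N - \<beta> * ?f"
    using num_loading_le_num_accepted[of v M Jold Jnew srv taken p] by simp
  then show ?thesis
    unfolding revenue_def N f using \<open>p \<le> q\<close>
    by (intro mult_left_mono divide_right_mono) auto
qed

text \<open>Take a cheapest bid \<open>i\<close> among those passing \<open>p\<close>. Every bid
  passing \<open>p\<close> costs at least \<open>v i\<close> by minimality, and every bid passing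
  \<open>v i\<close> passes \<open>p\<close> because \<open>p \<le> v i\<close>.\<close>

lemma lowest_passing_bid:
  assumes "finite B" "bids_at_least v B p \<noteq> {}"
  obtains i where "i \<in> B" "p \<le> v i" "bids_at_least v B (v i) = bids_at_least v B p"
proof -
  have "finite (bids_at_least v B p)"
    using assms(1) by (simp add: bids_at_least_def)
  then obtain i where "is_arg_min v (\<lambda>i. i \<in> bids_at_least v B p) i"
    using ex_is_arg_min_if_finite assms(2) by blast
  then have "i \<in> B" "p \<le> v i" "bids_at_least v B (v i) = bids_at_least v B p"
    by (force simp: is_arg_min_linorder bids_at_least_def)+
  then show thesis by (rule that)
qed

theorem proposition4p3:
  fixes A M L :: nat and \<beta> p_opt :: real and v :: "nat \<Rightarrow> real"
    and Jold Jnew :: "nat set" and srv :: "nat \<Rightarrow> 's" and taken :: "'s set"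
  assumes "A \<ge> 1"
    and "Jold \<union> Jnew = {1..A}" and "Jold \<inter> Jnew = {}"
    and "antimono_on {1..A} v" and "v A \<ge> 0"
    and "L > 0" and "0 < \<beta>" and "\<beta> < 1"
    and "is_arg_max (revenue L \<beta> v M Jold Jnew srv taken) (\<lambda>p. p \<in> candidate_prices v A) p_opt"
  shows "is_arg_max (revenue L \<beta> v M Jold Jnew srv taken) (\<lambda>p. p \<ge> 0) p_opt"
proof -
  let ?R = "revenue L \<beta> v M Jold Jnew srv taken"
  have opt: "p_opt \<in> candidate_prices v A" "\<And>p. p \<in> candidate_prices v A \<Longrightarrow> ?R p \<le> ?R p_opt"
    using assms(9) by (auto simp: is_arg_max_linorder)
  have anti: "v j \<le> v i" if "1 \<le> i" "i \<le> j" "j \<le> A" for i j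
    using monotone_onD[OF assms(4), of i j] that by simp
  have "0 \<le> v i" if "i \<in> {1..A}" for i
    using anti[of i A] that assms(5) by simp
  \<comment> \<open>Since \<open>A \<ge> 1\<close>, bid 1 exists, so \<open>v 1 \<ge> 0\<close> and
    the extra candidate \<open>v 1 + 1\<close> is nonnegative too.\<close>
  then have "0 \<le> p_opt"
    using opt(1) assms(1) by (force simp: candidate_prices_def)
  moreover have "?R p \<le> ?R p_opt" for p
  proof (cases "bids_at_least v {1..A} p = {}")
    case True
    \<comment> \<open>By the ordering \<open>v 1\<close> is the highest bid price, so a price
      strictly above it rejects every bid.\<close>
    have "bids_at_least v {1..A} (v 1 + 1) = {}"
      using anti[of 1] by (fastforce simp: bids_at_least_def)
    then have "?R p = ?R (v 1 + 1)"
      using True assms(2) by (simp add: revenue_eq_0)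
    also have "\<dots> \<le> ?R p_opt"
      by (rule opt(2)) (simp add: candidate_prices_def)
    finally show ?thesis .
  next
    case False
    then obtain i where i: "i \<in> {1..A}" "p \<le> v i"
      "bids_at_least v {1..A} (v i) = bids_at_least v {1..A} p"
      using lowest_passing_bid[of "{1..A}" v p] by blast
    then have "?R p \<le> ?R (v i)"
      using assms(2,8) by (intro revenue_mono_same_bids) auto
    also have "\<dots> \<le> ?R p_opt"
      using i(1) by (intro opt(2)) (simp add: candidate_prices_def)
    finally show ?thesis .
  qed
  ultimately show ?thesis
    by (simp add: is_arg_max_linorder)
qed

end
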